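(* Let $f$ be a positive integer and let $(a,a+f,c)$ be a primitive Pythagorean triple; write $b=a+f$. Then there exist $m\in\mathbb{Z}$, a choice of sign $\pm$, and an element $\mathfrak{u}\in\mathfrak{C}_f$ such that, writing $X+Y\sqrt{2}=\pm\gamma\delta^m\mathfrak{u}^2$ with $X,Y\in\mathbb{Z}$, one has $$a=\frac{X-f}{2},\qquad b=\frac{X+f}{2},\qquad c=Y.$$
   Context: A Pythagorean triple is a triple of integers $(a,b,c)\in\mathbb{Z}^3$ such that $a^2+b^2=c^2$. It is primitive if the only integer $d>0$ dividing all of $a$, $b$ and $c$ is $d=1$. In $\mathbb{Z}[\sqrt{2}]$ let $\gamma=1+\sqrt{2}$ and $\delta=\gamma^2=3+2\sqrt{2}$, and let the bar denote conjugation $\overline{x+y\sqrt2}=x-y\sqrt2$. The ring $\mathbb{Z}[\sqrt2]$ is a principal ideal domain. If a primitive Pythagorean triple $(a,a+f,c)$ exists, then every prime dividing $f$ is congruent to $\pm1$ modulo $8$. Write $f=p_1^{t_1}\cdots p_n^{t_n}$ with $p_i$ distinct primes and $t_i\in\mathbb{Z}^+$. Each $p_i\equiv\pm1 \pmod 8$ splits in $\mathbb{Z}[\sqrt2]$ as $(p_i)=\mathfrak{p}_i\bar{\mathfrak{p}}_i$ with $\mathfrak{p}_i,\bar{\mathfrak{p}}_i$ prime ideals. The set $\mathfrak{C}_f$ consists of the elements $\mathfrak{u}\in\mathbb{Z}[\sqrt2]$ with $\mathfrak{u}\bar{\mathfrak{u}}=f$ that generate an ideal of the form $\prod_{i=1}^n\mathfrak{q}_i^{t_i}$,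 where for each $i$ either $\mathfrak{q}_i=\mathfrak{p}_i$ or $\mathfrak{q}_i=\bar{\mathfrak{p}}_i$. *)

theory Defs
  imports
    Complex_Main
    "HOL-Computational_Algebra.Primes"
    "HOL-Algebra.Ideal_Product"
begin

definition pythagorean_triple :: "int \<Rightarrow> int \<Rightarrow> int \<Rightarrow> bool" where
  "pythagorean_triple a b c \<longleftrightarrow> a\<^sup>2 + b\<^sup>2 = c\<^sup>2"

definition primitive_triple :: "int \<Rightarrow> int \<Rightarrow> int \<Rightarrow> bool" where
  "primitive_triple a b c \<longleftrightarrow> (\<forall>d>0. d dvd a \<and> d dvd b \<and> d dvd c \<longrightarrow> d = 1)"

text \<open>The ring \<open>\<int>[\<surd>2]\<close> is realised as a subring of the reals.\<close>

definition zsqrt2 :: "real ring" where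
  "zsqrt2 = \<lparr> carrier = {of_int x + of_int y * sqrt 2 | x y. True},
              mult = (*), one = 1, zero = 0, add = (+) \<rparr>"

definition zsqrt2_gamma :: real where
  "zsqrt2_gamma = 1 + sqrt 2"

definition zsqrt2_delta :: real where
  "zsqrt2_delta = zsqrt2_gamma\<^sup>2"

text \<open>Conjugation is only meaningful on the carrier of \<^const>\<open>zsqrt2\<close>, where the
  description is unique by irrationality of \<open>\<surd>2\<close> (lemma \<open>zsqrt2_conj_eq\<close> below).\<close>

definition zsqrt2_conj :: "real \<Rightarrow> real" where
  "zsqrt2_conj z = (THE w. \<exists>x y. z = of_int x + of_int y * sqrt 2 \<and>
                                w = of_int x - of_int y * sqrt 2)"

lemma sqrt2_not_Rats: "sqrt 2 \<notin> \<rat>"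
proof
  assume "sqrt 2 \<in> \<rat>"
  then obtain m n :: nat where n: "n \<noteq> 0" and e: "\<bar>sqrt 2\<bar> = real m / real n"
    and c: "coprime m n"
    by (rule Rats_abs_nat_div_natE)
  have "real m = sqrt 2 * real n" using n e by (simp add: field_simps)
  hence "(real m)\<^sup>2 = 2 * (real n)\<^sup>2" by (simp add: power_mult_distrib)
  hence eq: "m\<^sup>2 = 2 * n\<^sup>2"
    by (metis (mono_tags) of_nat_eq_iff of_nat_mult of_nat_numeral of_nat_power)
  hence "even (m\<^sup>2)" by simp
  hence em: "even m" by simp
  then obtain k where "m = 2 * k" by blast
  hence "n\<^sup>2 = 2 * k\<^sup>2" using eq by (simp add: power2_eq_square)
  hence "even (n\<^sup>2)" by simp
  hence "even n" by simp
  thus False using em c by (metis coprime_common_divisor odd_one)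
qed

lemma zsqrt2_coords_unique:
  fixes x y x' y' :: int
  assumes "of_int x + of_int y * sqrt 2 = of_int x' + of_int y' * sqrt 2"
  shows "x = x' \<and> y = y'"
proof -
  have "y = y'"
  proof (rule ccontr)
    assume "y \<noteq> y'"
    hence "real_of_int (y - y') \<noteq> 0" by simp
    moreover have "sqrt 2 * of_int (y - y') = of_int (x' - x)"
      using assms by (simp add: algebra_simps)
    ultimately have "sqrt 2 = of_int (x' - x) / of_int (y - y')"
      by (metis nonzero_eq_divide_eq)
    hence "sqrt 2 \<in> \<rat>" by (metis Rats_divide Rats_of_int)
    thus False using sqrt2_not_Rats by blast
  qed
  thus ?thesis using assms by simp
qed

lemma zsqrt2_conj_eq:
  "zsqrt2_conj (of_int x + of_int y * sqrt 2) = of_int x - of_int y * sqrt 2"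
  unfolding zsqrt2_conj_def by (rule the_equality) (blast dest: zsqrt2_coords_unique)+

lemma zsqrt2_memI: "of_int x + of_int y * sqrt 2 \<in> carrier zsqrt2"
  unfolding zsqrt2_def by auto

lemma cring_zsqrt2: "cring zsqrt2"
proof (rule cringI)
  have add: "u + v \<in> carrier zsqrt2" and mult: "u * v \<in> carrier zsqrt2"
    if "u \<in> carrier zsqrt2" "v \<in> carrier zsqrt2" for u v
  proof -
    from that obtain x y x' y' :: int where
      uv: "u = of_int x + of_int y * sqrt 2" "v = of_int x' + of_int y' * sqrt 2"
      by (auto simp: zsqrt2_def)
    have "u + v = of_int (x + x') + of_int (y + y') * sqrt 2"
      by (simp add: uv algebra_simps)
    thus "u + v \<in> carrier zsqrt2" by (metis zsqrt2_memI)
    have "u * v = of_int (x * x' + 2 * y * y') + of_int (x * y' + y * x') * sqrt 2"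
      by (simp add: uv algebra_simps)
    thus "u * v \<in> carrier zsqrt2" by (metis zsqrt2_memI)
  qed
  have const: "of_int n \<in> carrier zsqrt2" for n
    using zsqrt2_memI[of n 0] by simp
  note zero = const[of 0, simplified] and one = const[of 1, simplified]
  have neg: "- u \<in> carrier zsqrt2" if "u \<in> carrier zsqrt2" for u
    using mult[OF const[of "- 1"] that] by simp
  show "abelian_group zsqrt2"
  proof (rule abelian_groupI)
    fix u assume "u \<in> carrier zsqrt2"
    thus "\<exists>v\<in>carrier zsqrt2. v \<oplus>\<^bsub>zsqrt2\<^esub> u = \<zero>\<^bsub>zsqrt2\<^esub>"
      using neg by (intro bexI[of _ "- u"]) (auto simp: zsqrt2_def)
  qed (use add zero in \<open>auto simp: zsqrt2_def\<close>)
  show "comm_monoid zsqrt2"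
    by (rule comm_monoidI) (use mult one in \<open>auto simp: zsqrt2_def\<close>)
qed (auto simp: zsqrt2_def algebra_simps)

text \<open>As usual, \<open>splits\<close> excludes the ramified case, where \<open>P\<close> equals its conjugate.\<close>

definition splits_as :: "int \<Rightarrow> real set \<Rightarrow> bool" where
  "splits_as p P \<longleftrightarrow>
     primeideal P zsqrt2 \<and> primeideal (zsqrt2_conj ` P) zsqrt2 \<and> P \<noteq> zsqrt2_conj ` P \<and>
     PIdl\<^bsub>zsqrt2\<^esub> (of_int p) = P \<cdot>\<^bsub>zsqrt2\<^esub> (zsqrt2_conj ` P)"

text \<open>Only used for \<open>f > 0\<close>.  The set does not depend on which of the two primes above
  each \<open>p\<close> is called \<open>P p\<close>, so that choice is bound existentially.\<close>

definition frakC :: "int \<Rightarrow> real set" where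
  "frakC f = {u \<in> carrier zsqrt2.
     u * zsqrt2_conj u = of_int f \<and>
     (\<exists>P Q. (\<forall>p\<in>prime_factors f.
               splits_as p (P p) \<and> (Q p = P p \<or> Q p = zsqrt2_conj ` P p)) \<and>
            PIdl\<^bsub>zsqrt2\<^esub> u =
              (\<Otimes>\<^bsub>ideals_set zsqrt2\<^esub> p\<in>prime_factors f.
                 Q p [^]\<^bsub>ideals_set zsqrt2\<^esub> multiplicity p f))}"

end

theory Submission
  imports Defs
begin

text \<open>Put \<open>X = a + b\<close> and \<open>z = X + c\<surd>2\<close>.  The equation \<open>a\<^sup>2 + b\<^sup>2 = c\<^sup>2\<close> says exactly that \<open>z\<close> has
  norm \<open>X\<^sup>2 - 2c\<^sup>2 = - (b - a)\<^sup>2 = - f\<^sup>2\<close>, and primitivity makes \<open>2X\<close> coprime to \<open>f\<close>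
  (lemma \<open>primitive_triple_coprime_trace\<close>).  Since \<open>z\<close> and its conjugate \<open>z'\<close> satisfy
  \<open>z z' = - f\<^sup>2\<close> and \<open>z + z' = 2X\<close>, the ideal \<open>(z, f)\<close> squares to
  \<open>(z\<^sup>2, zf, z z') = z (z, f, z') = (z)\<close>.  As \<open>\<int>[\<surd>2]\<close> is a principal ideal domain, \<open>(z, f)\<close>
  has a generator \<open>u\<close>, so \<open>z\<close> is a unit times \<open>u\<^sup>2\<close>; comparing norms, the unit has norm \<open>-1\<close>
  and \<open>u\<close> has norm \<open>\<plusminus>f\<close>, where multiplying \<open>u\<close> by \<open>\<gamma>\<close> corrects the sign
  (lemma \<open>norm_minus_square_decompose\<close>).  The units of norm \<open>-1\<close> are the numbers
  \<open>\<plusminus>\<gamma>\<delta>\<^sup>m\<close> (lemma \<open>unit_norm_minus_1\<close>), which gives the formula for \<open>z\<close>.\<close>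

text \<open>It remains to factor the ideal \<open>(u)\<close> for \<open>u = x + y\<surd>2\<close> of norm \<open>f\<close>.  For every divisor
  \<open>d\<close> of \<open>f\<close>, prime or not, let \<open>Q d\<close> be the set of all \<open>s + t\<surd>2\<close> for which
  \<open>(s, t)\<close> is proportional to \<open>(x, y)\<close> modulo \<open>d\<close>.  Because \<open>2x\<close> is coprime to \<open>f\<close>, this is the
  ideal \<open>(d, u)\<close>, and these ideals satisfy \<open>Q d Q e = Q (d e)\<close> whenever \<open>d e\<close> divides \<open>f\<close>
  (lemma \<open>Q_mult\<close>).  Hence \<open>(u) = Q f\<close> is the product of the powers of the \<open>Q p\<close> along the
  prime factorization of the integer \<open>f\<close>, and each \<open>Q p\<close> is a prime ideal with
  \<open>(p)\<close> as its product with its conjugate (lemma \<open>splits_as_Q\<close>).\<close>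

section \<open>\<open>\<int>[\<surd>2]\<close> in coordinates\<close>

definition zs :: "int \<Rightarrow> int \<Rightarrow> real" where
  "zs x y = of_int x + of_int y * sqrt 2"

definition nrm :: "int \<Rightarrow> int \<Rightarrow> int" where
  "nrm x y = x\<^sup>2 - 2 * y\<^sup>2"

interpretation zsqrt2: cring zsqrt2
  by (rule cring_zsqrt2)

lemma zsqrt2_simps [simp]:
  "mult zsqrt2 = (*)" "one zsqrt2 = 1" "zero zsqrt2 = 0" "add zsqrt2 = (+)"
  by (simp_all add: zsqrt2_def)

lemma zs_in_carrier [simp]: "zs x y \<in> carrier zsqrt2"
  unfolding zs_def by (rule zsqrt2_memI)

lemma carrier_zsqrt2E:
  assumes "z \<in> carrier zsqrt2"
  obtains x y where "z = zs x y"
  using assms by (auto simp: zsqrt2_def zs_def)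

lemma of_int_eq_zs: "of_int n = zs n 0"
  by (simp add: zs_def)

lemma of_int_in_carrier [simp]: "of_int n \<in> carrier zsqrt2"
  by (simp add: of_int_eq_zs)

lemma zs_eq_iff: "zs x y = zs x' y' \<longleftrightarrow> x = x' \<and> y = y'"
  unfolding zs_def using zsqrt2_coords_unique by blast

lemma zs_add: "zs x y + zs x' y' = zs (x + x') (y + y')"
  by (simp add: zs_def algebra_simps)

lemma zs_diff: "zs x y - zs x' y' = zs (x - x') (y - y')"
  by (simp add: zs_def algebra_simps)

lemma zs_mult: "zs x y * zs x' y' = zs (x * x' + 2 * y * y') (x * y' + y * x')"
  by (simp add: zs_def algebra_simps)

lemma zs_conj: "zsqrt2_conj (zs x y) = zs x (- y)"
  unfolding zs_def using zsqrt2_conj_eq[of x y] by simp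

lemma zs_mult_conj: "zs x y * zs x (- y) = of_int (nrm x y)"
  by (simp add: zs_mult of_int_eq_zs zs_eq_iff nrm_def power2_eq_square)

lemma add_in_carrier: "u \<in> carrier zsqrt2 \<Longrightarrow> v \<in> carrier zsqrt2 \<Longrightarrow> u + v \<in> carrier zsqrt2"
  using zsqrt2.a_closed by simp

lemma mult_in_carrier: "u \<in> carrier zsqrt2 \<Longrightarrow> v \<in> carrier zsqrt2 \<Longrightarrow> u * v \<in> carrier zsqrt2"
  using zsqrt2.m_closed by simp

lemma diff_in_carrier: "u \<in> carrier zsqrt2 \<Longrightarrow> v \<in> carrier zsqrt2 \<Longrightarrow> u - v \<in> carrier zsqrt2"
  by (metis carrier_zsqrt2E zs_diff zs_in_carrier)

lemmas carrier_closed = add_in_carrier mult_in_carrier diff_in_carrier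

lemma nrm_mult: "nrm (x * x' + 2 * y * y') (x * y' + y * x') = nrm x y * nrm x' y'"
  unfolding nrm_def by Groebner_Basis.algebra

lemma nrm_eq_0_iff: "nrm x y = 0 \<longleftrightarrow> x = 0 \<and> y = 0"
proof
  assume "nrm x y = 0"
  then have "zs x y * zs x (- y) = 0" by (simp add: zs_mult_conj)
  then have "zs x y = zs 0 0 \<or> zs x (- y) = zs 0 0" by (simp add: zs_def)
  then show "x = 0 \<and> y = 0" by (auto simp: zs_eq_iff)
qed (simp add: nrm_def)

section \<open>Ideals of \<open>\<int>[\<surd>2]\<close>\<close>

lemma ideal_zsqrt2I:
  assumes sub: "I \<subseteq> carrier zsqrt2" and zero: "0 \<in> I"
    and add: "\<And>u v. u \<in> I \<Longrightarrow> v \<in> I \<Longrightarrow> u + v \<in> I"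
    and mult: "\<And>r u. r \<in> carrier zsqrt2 \<Longrightarrow> u \<in> I \<Longrightarrow> r * u \<in> I"
  shows "ideal I zsqrt2"
proof (rule idealI)
  show "ring zsqrt2" by (rule zsqrt2.ring_axioms)
  have neg: "- u \<in> I" if "u \<in> I" for u
    using mult[OF of_int_in_carrier[of "- 1"] that] by simp
  show "subgroup I (add_monoid zsqrt2)"
  proof (rule zsqrt2.add.subgroupI)
    show "\<ominus>\<^bsub>zsqrt2\<^esub> u \<in> I" if "u \<in> I" for u
    proof -
      have "\<ominus>\<^bsub>zsqrt2\<^esub> u = - u"
        using that sub neg by (intro zsqrt2.minus_equality) auto
      then show ?thesis using neg that by simp
    qed
  qed (use sub zero add in auto)
  fix u r assume u: "u \<in> I" and r: "r \<in> carrier zsqrt2"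
  show "r \<otimes>\<^bsub>zsqrt2\<^esub> u \<in> I" "u \<otimes>\<^bsub>zsqrt2\<^esub> r \<in> I"
    using mult[OF r u] by (simp_all add: mult.commute[of u])
qed

lemma ideal_zsqrt2_addD:
  assumes "ideal I zsqrt2" "u \<in> I" "v \<in> I" shows "u + v \<in> I"
  using additive_subgroup.a_closed[OF ideal.axioms(1)[OF assms(1)] assms(2,3)] by simp

lemma ideal_zsqrt2_multD:
  assumes "ideal I zsqrt2" "r \<in> carrier zsqrt2" "u \<in> I" shows "r * u \<in> I"
  using ideal.I_l_closed[OF assms(1,3,2)] by simp

lemma ideal_prod_subsetI:
  assumes "ideal K zsqrt2" "\<And>u v. u \<in> I \<Longrightarrow> v \<in> J \<Longrightarrow> u * v \<in> K"
  shows "I \<cdot>\<^bsub>zsqrt2\<^esub> J \<subseteq> K"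
proof
  fix s assume "s \<in> I \<cdot>\<^bsub>zsqrt2\<^esub> J"
  then show "s \<in> K"
    by induction (use assms ideal_zsqrt2_addD in auto)
qed

lemma ideal_prod_memI: "u \<in> I \<Longrightarrow> v \<in> J \<Longrightarrow> u * v \<in> I \<cdot>\<^bsub>zsqrt2\<^esub> J"
  using ideal_prod.prod[of u I v J zsqrt2] by simp

lemma PIdl_iff: "v \<in> PIdl\<^bsub>zsqrt2\<^esub> u \<longleftrightarrow> (\<exists>r\<in>carrier zsqrt2. v = r * u)"
  by (auto simp: cgenideal_def)

lemma coprime_bezout_int:
  assumes "coprime (m::int) n" obtains a b where "a * m + b * n = 1"
  using assms bezout_int[of m n] by auto

text \<open>The ring is norm-Euclidean: a generator is a nonzero element of least absolute norm, because
  rounding both coordinates of a quotient in \<open>\<rat>(\<surd>2)\<close> leaves an error of norm at most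
  \<open>2 \<sqdot> (1/2)\<^sup>2 = 1/2\<close> in absolute value.\<close>

lemma ideal_zsqrt2_principal:
  assumes I: "ideal I zsqrt2"
  shows "\<exists>u\<in>I. I = PIdl\<^bsub>zsqrt2\<^esub> u"
proof (cases "I = {0}")
  case True
  then show ?thesis
    using of_int_in_carrier[of 1] by (auto simp: PIdl_iff)
next
  case False
  have zero: "0 \<in> I"
    using additive_subgroup.zero_closed[OF ideal.axioms(1)[OF I]] by simp
  have sub: "I \<subseteq> carrier zsqrt2"
    using ideal.Icarr[OF I] by blast
  define P where "P = (\<lambda>(x, y). zs x y \<in> I \<and> zs x y \<noteq> 0)"
  obtain v where "v \<in> I" "v \<noteq> 0" using False zero by blast
  moreover from this obtain s t where "v = zs s t" using sub carrier_zsqrt2E by blast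
  ultimately have "P (s, t)" by (simp add: P_def)
  then obtain p where p: "P p" "\<forall>q. P q \<longrightarrow> nat \<bar>case_prod nrm p\<bar> \<le> nat \<bar>case_prod nrm q\<bar>"
    using ex_has_least_nat[of P "(s, t)" "\<lambda>q. nat \<bar>case_prod nrm q\<bar>"] by blast
  obtain x y where xy: "p = (x, y)" by (rule prod.exhaust)
  have P: "P (x, y)" using p xy by simp
  have min: "nat \<bar>nrm x y\<bar> \<le> nat \<bar>nrm s t\<bar>" if "P (s, t)" for s t
    using p(2)[rule_format, OF that] by (simp add: xy)
  define n where "n = nrm x y"
  have n0: "n \<noteq> 0" using P by (auto simp: n_def P_def nrm_eq_0_iff zs_def)
  have "I \<subseteq> PIdl\<^bsub>zsqrt2\<^esub> (zs x y)"
  proof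
    fix z assume z: "z \<in> I"
    then obtain s t where st: "z = zs s t" using sub carrier_zsqrt2E by blast
    \<comment> \<open>The quotient of \<open>z\<close> by \<open>x + y\<surd>2\<close> has the coordinates \<open>A / n\<close> and \<open>B / n\<close>.\<close>
    define A B where "A = s * x - 2 * t * y" and "B = t * x - s * y"
    define q r where "q = round (of_int A / of_int n :: real)"
      and "r = round (of_int B / of_int n :: real)"
    define s' t' where "s' = s - (q * x + 2 * r * y)" and "t' = t - (q * y + r * x)"
    have half: "4 * (C - round (of_int C / of_int n :: real) * n)\<^sup>2 \<le> n\<^sup>2" for C :: int
    proof -
      define k where "k = round (of_int C / of_int n :: real)"
      have "\<bar>of_int k - of_int C / of_int n :: real\<bar> \<le> 1 / 2"
        unfolding k_def by (rule of_int_round_abs_le)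
      then have "\<bar>of_int k - of_int C / of_int n :: real\<bar> * \<bar>of_int n\<bar> \<le> 1 / 2 * \<bar>of_int n\<bar>"
        by (intro mult_right_mono) auto
      also have "\<bar>of_int k - of_int C / of_int n :: real\<bar> * \<bar>of_int n\<bar> = of_int \<bar>C - k * n\<bar>"
        using n0 by (simp add: abs_mult[symmetric] left_diff_distrib abs_minus_commute)
      finally have "real_of_int (2 * \<bar>C - k * n\<bar>) \<le> real_of_int \<bar>n\<bar>" by simp
      then have "\<bar>2 * (C - k * n)\<bar> \<le> \<bar>n\<bar>"
        by (simp only: of_int_le_iff abs_mult abs_numeral)
      then have "(2 * (C - k * n))\<^sup>2 \<le> n\<^sup>2" by (simp only: abs_le_square_iff)
      then show ?thesis unfolding k_def[symmetric] by (simp only: power_mult_distrib) simp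
    qed
    have diff: "zs s' t' = z - zs q r * zs x y"
      by (simp add: st s'_def t'_def zs_mult zs_diff zs_eq_iff)
    \<comment> \<open>The right-hand side is the norm of \<open>(s' + t'\<surd>2) (x - y\<surd>2)\<close>,
      whose coordinates are the two rounding errors times \<open>n\<close>.\<close>
    have key: "nrm s' t' * n = (A - q * n)\<^sup>2 - 2 * (B - r * n)\<^sup>2"
      unfolding nrm_def n_def A_def B_def s'_def t'_def by Groebner_Basis.algebra
    have "4 * \<bar>nrm s' t' * n\<bar> \<le> 2 * n\<^sup>2"
    proof -
      have "4 * \<bar>i - 2 * j\<bar> \<le> 2 * m" if "4 * i \<le> m" "4 * j \<le> m" "0 \<le> i" "0 \<le> j" for i j m :: int
        using that by arith
      then show ?thesis
        unfolding key using half[of A] half[of B] by (simp only: q_def[symmetric] r_def[symmetric] zero_le_power2)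
    qed
    then have "(2 * \<bar>nrm s' t'\<bar>) * \<bar>n\<bar> \<le> \<bar>n\<bar> * \<bar>n\<bar>"
      unfolding abs_mult power2_eq_square abs_mult_self_eq by linarith
    then have "2 * \<bar>nrm s' t'\<bar> \<le> \<bar>n\<bar>"
      using n0 by (simp only: mult_le_cancel_right)
    then have "nat \<bar>nrm s' t'\<bar> < nat \<bar>nrm x y\<bar>"
      using n0 n_def by linarith
    then have "\<not> P (s', t')" using min[of s' t'] by linarith
    moreover have "zs s' t' \<in> I"
    proof -
      have "zs s' t' = z + zs (- q) (- r) * zs x y"
        by (simp add: diff) (simp add: zs_def algebra_simps)
      then show ?thesis
        using z P I by (auto simp: P_def intro!: ideal_zsqrt2_addD ideal_zsqrt2_multD)
    qed
    ultimately have "z = zs q r * zs x y" using diff by (simp add: P_def)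
    then show "z \<in> PIdl\<^bsub>zsqrt2\<^esub> (zs x y)" by (auto simp: PIdl_iff)
  qed
  moreover have "PIdl\<^bsub>zsqrt2\<^esub> (zs x y) \<subseteq> I"
    using I P by (auto simp: PIdl_iff P_def intro: ideal_zsqrt2_multD)
  ultimately show ?thesis using P by (auto simp: P_def)
qed

section \<open>The ideals above the divisors of a norm\<close>

text \<open>The coprimality says that \<open>u = x + y\<surd>2\<close> and its conjugate generate the unit ideal: their
  sum is \<open>2x\<close> and their product is \<open>f\<close>.  Both assumptions are invariant under \<open>y \<mapsto> - y\<close>, so
  every result below also holds for the conjugate element.\<close>

locale coprime_norm =
  fixes x y f :: int
  assumes norm_eq: "nrm x y = f" and coprime_trace: "coprime (2 * x) f"
begin

abbreviation u :: real where "u \<equiv> zs x y"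

text \<open>For \<open>d\<close> dividing \<open>f\<close> this is the ideal \<open>(d, u)\<close>.  Described by one congruence, membership
  becomes a divisibility of integers.\<close>

definition Q :: "int \<Rightarrow> real set" where
  "Q d = {zs s t | s t. d dvd s * y - t * x}"

lemma zs_mem_Q: "zs s t \<in> Q d \<longleftrightarrow> d dvd s * y - t * x"
  unfolding Q_def by (auto simp: zs_eq_iff)

lemma Q_subset: "Q d \<subseteq> carrier zsqrt2"
  by (auto simp: Q_def)

lemma u_mem_Q: "u \<in> Q d"
  by (simp add: zs_mem_Q mult.commute)

lemma mem_Q_self: "of_int d \<in> Q d"
  by (simp add: of_int_eq_zs zs_mem_Q)

lemma coprime_y: "coprime y f"
proof (rule coprimeI)
  fix d assume "d dvd y" "d dvd f"
  have "x * x = f + (2 * y) * y"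
    using norm_eq by (simp add: nrm_def power2_eq_square)
  then have "d dvd x * x" using \<open>d dvd y\<close> \<open>d dvd f\<close> by simp
  moreover have "coprime (x * x) f" using coprime_trace by simp
  ultimately show "is_unit d" using \<open>d dvd f\<close> coprime_common_divisor by blast
qed

text \<open>Being invertible modulo every divisor of \<open>f\<close>, the coordinate \<open>y\<close> may be cancelled; several
  congruences are visible only after multiplication by \<open>y\<close>.\<close>

lemma dvd_cancel_y:
  assumes "d dvd f" "d dvd y * w" shows "d dvd w"
proof -
  have "coprime d y"
    using coprime_y assms(1) by (meson coprime_commute coprime_divisors dvd_refl)
  then show ?thesis using assms(2) by (simp add: coprime_dvd_mult_right_iff)
qed

lemma ideal_Q:
  assumes d: "d dvd f" shows "ideal (Q d) zsqrt2"
proof (rule ideal_zsqrt2I)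
  show "0 \<in> Q d" using zs_mem_Q[of 0 0 d] by (simp add: zs_def)
next
  fix v w assume "v \<in> Q d" "w \<in> Q d"
  then obtain s t s' t' where vw: "v = zs s t" "w = zs s' t'"
    and dvd: "d dvd s * y - t * x" "d dvd s' * y - t' * x"
    by (auto simp: Q_def)
  have "(s + s') * y - (t + t') * x = (s * y - t * x) + (s' * y - t' * x)"
    by (simp add: algebra_simps)
  then show "v + w \<in> Q d" using dvd by (simp add: vw zs_add zs_mem_Q)
next
  fix v w assume "v \<in> carrier zsqrt2" "w \<in> Q d"
  then obtain a b s t where vw: "v = zs a b" "w = zs s t" and dvd: "d dvd s * y - t * x"
    by (auto simp: Q_def elim!: carrier_zsqrt2E)
  have eq: "y * ((a * s + 2 * b * t) * y - (a * t + b * s) * x)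
      = (a * y - b * x) * (s * y - t * x) - b * t * f"
    unfolding norm_eq[symmetric] nrm_def by Groebner_Basis.algebra
  have "d dvd y * ((a * s + 2 * b * t) * y - (a * t + b * s) * x)"
    unfolding eq by (rule dvd_diff[OF dvd_mult[OF dvd] dvd_mult[OF d]])
  then have "d dvd (a * s + 2 * b * t) * y - (a * t + b * s) * x"
    by (rule dvd_cancel_y[OF d])
  then show "v * w \<in> Q d" by (simp only: vw zs_mult zs_mem_Q)
qed (rule Q_subset)

text \<open>This is the inclusion of \<open>Q d\<close> in \<open>(d, u)\<close>: an integer multiple of \<open>u\<close> matches the second
  coordinate modulo \<open>d\<close>, and proportionality then forces the first one to match.\<close>

lemma Q_decompose:
  assumes d: "d dvd f" and v: "v \<in> Q d"
  obtains w k where "w \<in> carrier zsqrt2" "v = of_int d * w + of_int k * u"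
proof -
  obtain s t where st: "v = zs s t" and dvd: "d dvd s * y - t * x"
    using v by (auto simp: Q_def)
  have "coprime y d" using coprime_y d by (meson coprime_divisors dvd_refl)
  then obtain a b where ab: "a * y + b * d = 1" by (rule coprime_bezout_int)
  \<comment> \<open>Modulo \<open>d\<close> the inverse of \<open>y\<close> is \<open>a\<close>, so \<open>k\<close> solves \<open>k y \<equiv> t\<close>.\<close>
  define k where "k = a * t"
  have "t - k * y = d * (b * t)"
    using ab unfolding k_def by Groebner_Basis.algebra
  then have 1: "d dvd t - k * y" by simp
  have eq: "y * (s - k * x) = (s * y - t * x) + x * (t - k * y)" by Groebner_Basis.algebra
  have "d dvd y * (s - k * x)" unfolding eq by (rule dvd_add[OF dvd dvd_mult[OF 1]])
  then have "d dvd s - k * x" by (rule dvd_cancel_y[OF d])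
  then obtain e e' where "s - k * x = d * e" "t - k * y = d * e'"
    using 1 by (auto elim!: dvdE)
  then have "v = of_int d * zs e e' + of_int k * u"
    by (simp add: st of_int_eq_zs zs_mult zs_add zs_eq_iff)
  then show ?thesis using that zs_in_carrier by blast
qed

lemma Q_1: "Q 1 = carrier zsqrt2"
proof
  show "carrier zsqrt2 \<subseteq> Q 1"
  proof
    fix v assume "v \<in> carrier zsqrt2"
    then obtain s t where "v = zs s t" by (rule carrier_zsqrt2E)
    then show "v \<in> Q 1" by (simp add: zs_mem_Q)
  qed
qed (rule Q_subset)

lemma Q_norm: "Q f = PIdl\<^bsub>zsqrt2\<^esub> u"
proof
  show "PIdl\<^bsub>zsqrt2\<^esub> u \<subseteq> Q f"
    by (intro zsqrt2.cgenideal_minimal ideal_Q u_mem_Q dvd_refl)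
  show "Q f \<subseteq> PIdl\<^bsub>zsqrt2\<^esub> u"
  proof
    fix v assume "v \<in> Q f"
    then obtain w k where w: "w \<in> carrier zsqrt2" and v: "v = of_int f * w + of_int k * u"
      using Q_decompose[of f] by auto
    have "v = (zs x (- y) * w + of_int k) * u"
      by (simp add: v norm_eq[symmetric] zs_mult_conj[symmetric] algebra_simps)
    moreover have "zs x (- y) * w + of_int k \<in> carrier zsqrt2"
      using w by (intro carrier_closed) auto
    ultimately show "v \<in> PIdl\<^bsub>zsqrt2\<^esub> u" by (auto simp: PIdl_iff)
  qed
qed

lemma u_add_conj: "u + zs x (- y) = of_int (2 * x)"
  by (simp add: zs_def)

text \<open>With \<open>Q d = (d, u)\<close> the product is \<open>(d e, d u, e u, u\<^sup>2)\<close>, which lies in \<open>(d e, u)\<close>.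
  For the converse it must contain \<open>u\<close> itself.  It contains \<open>d e u\<close>, and also
  \<open>2x u = u (u + u') = u\<^sup>2 + f\<close>, where \<open>u'\<close> is the conjugate; the integers \<open>2x\<close> and \<open>d e\<close>
  are coprime.  This covers powers of one prime as well as products of distinct ones.\<close>

lemma Q_mult:
  assumes de: "d * e dvd f"
  shows "Q d \<cdot>\<^bsub>zsqrt2\<^esub> Q e = Q (d * e)"
proof
  have d: "d dvd f" and e: "e dvd f" using de by (rule dvd_mult_left, rule dvd_mult_right)
  note Qde = ideal_Q[OF de]
  show "Q d \<cdot>\<^bsub>zsqrt2\<^esub> Q e \<subseteq> Q (d * e)"
  proof (rule ideal_prod_subsetI[OF Qde])
    fix v w assume "v \<in> Q d" "w \<in> Q e"
    then obtain v' w' k l where c: "v' \<in> carrier zsqrt2" "w' \<in> carrier zsqrt2"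
      and vw: "v = of_int d * v' + of_int k * u" "w = of_int e * w' + of_int l * u"
      using Q_decompose[OF d] Q_decompose[OF e] by metis
    have "v * w = (v' * w') * of_int (d * e)
        + (of_int (d * l) * v' + of_int (e * k) * w' + of_int (k * l) * u) * u"
      by (simp add: vw algebra_simps)
    also have "\<dots> \<in> Q (d * e)"
      using c by (intro ideal_zsqrt2_addD[OF Qde] ideal_zsqrt2_multD[OF Qde] carrier_closed
          mem_Q_self u_mem_Q of_int_in_carrier zs_in_carrier)
    finally show "v * w \<in> Q (d * e)" .
  qed
  let ?P = "Q d \<cdot>\<^bsub>zsqrt2\<^esub> Q e"
  have P: "ideal ?P zsqrt2" by (rule zsqrt2.ideal_prod_is_ideal[OF ideal_Q[OF d] ideal_Q[OF e]])
  have de_P: "of_int (d * e) \<in> ?P"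
    using ideal_prod_memI[OF mem_Q_self mem_Q_self, of d e] by simp
  obtain g where g: "f = (d * e) * g" using de by (auto elim: dvdE)
  have "coprime (2 * x) (d * e)" using coprime_trace de by (meson coprime_divisors dvd_refl)
  then obtain a b where ab: "a * (2 * x) + b * (d * e) = 1" by (rule coprime_bezout_int)
  have "of_int (2 * x) * u = u * u + of_int f"
    unfolding u_add_conj[symmetric] norm_eq[symmetric] zs_mult_conj[symmetric] by (simp add: algebra_simps)
  then have "of_int (a * (2 * x) + b * (d * e)) * u
      = of_int a * (u * u) + (of_int (a * g) + of_int b * u) * of_int (d * e)"
    unfolding g by (simp add: algebra_simps)
  then have u: "u = of_int a * (u * u) + (of_int (a * g) + of_int b * u) * of_int (d * e)"
    unfolding ab by simp
  have "\<dots> \<in> ?P"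
    by (intro ideal_zsqrt2_addD[OF P] ideal_zsqrt2_multD[OF P] ideal_prod_memI u_mem_Q de_P carrier_closed
        of_int_in_carrier zs_in_carrier)
  then have u_P: "u \<in> ?P" using u by simp
  show "Q (d * e) \<subseteq> ?P"
  proof
    fix v assume "v \<in> Q (d * e)"
    then obtain w k where w: "w \<in> carrier zsqrt2" and v: "v = of_int (d * e) * w + of_int k * u"
      using Q_decompose[OF de] by metis
    have "v = w * of_int (d * e) + of_int k * u" by (simp add: v mult.commute)
    also have "\<dots> \<in> ?P"
      using w by (intro ideal_zsqrt2_addD[OF P] ideal_zsqrt2_multD[OF P] u_P de_P) auto
    finally show "v \<in> ?P" .
  qed
qed

lemma Q_power:
  "d ^ n dvd f \<Longrightarrow> Q d [^]\<^bsub>ideals_set zsqrt2\<^esub> n = Q (d ^ n)"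
proof (induction n)
  case 0
  then show ?case by (simp add: Q_1 ideals_set_def)
next
  case (Suc n)
  have "d ^ n dvd f" using Suc.prems by (auto dest: dvd_mult_right)
  moreover have "Q (d ^ n) \<cdot>\<^bsub>zsqrt2\<^esub> Q d = Q (d ^ n * d)"
    using Suc.prems by (intro Q_mult) (simp add: mult.commute)
  ultimately show ?case using Suc.IH by (simp add: ideals_set_def mult.commute)
qed

lemma Q_finprod:
  assumes "finite A" "(\<Prod>p\<in>A. g p) dvd f"
  shows "(\<Otimes>\<^bsub>ideals_set zsqrt2\<^esub> p\<in>A. Q (g p)) = Q (\<Prod>p\<in>A. g p)"
  using assms
proof (induction A)
  interpret I: comm_monoid "ideals_set zsqrt2" by (rule zsqrt2.ideals_set_is_comm_monoid)
  case empty
  show ?case by (simp add: Q_1) (simp add: ideals_set_def)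
next
  interpret I: comm_monoid "ideals_set zsqrt2" by (rule zsqrt2.ideals_set_is_comm_monoid)
  case (insert p A)
  have dvd: "g p * (\<Prod>p\<in>A. g p) dvd f" using insert by simp
  then have "(\<Prod>p\<in>A. g p) dvd f" "g p dvd f" by (auto dest: dvd_mult_left dvd_mult_right)
  moreover have "g q dvd f" if "q \<in> A" for q
    using that insert.hyps \<open>(\<Prod>p\<in>A. g p) dvd f\<close> by (meson dvd_prodI dvd_trans)
  ultimately have "(\<Otimes>\<^bsub>ideals_set zsqrt2\<^esub> p\<in>insert p A. Q (g p)) = Q (g p) \<cdot>\<^bsub>zsqrt2\<^esub> Q (\<Prod>p\<in>A. g p)"
    using insert
    by (subst I.finprod_insert) (auto simp: ideals_set_def ideal_Q)
  then show ?case using insert by (simp add: Q_mult dvd)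
qed

text \<open>Conjugation exchanges the ideal of \<open>u\<close> with the ideal of the conjugate of \<open>u\<close>, to which the
  results of this section apply again.\<close>

lemma conj_Q: "zsqrt2_conj ` Q d = coprime_norm.Q x (- y) d"
proof -
  interpret c: coprime_norm x "- y" f
    using norm_eq coprime_trace by unfold_locales (simp_all add: nrm_def)
  have "zs s t \<in> zsqrt2_conj ` Q d \<longleftrightarrow> zs s t \<in> c.Q d" for s t
  proof -
    have "zs s t \<in> zsqrt2_conj ` Q d \<longleftrightarrow> zs s (- t) \<in> Q d"
    proof
      assume "zs s t \<in> zsqrt2_conj ` Q d"
      then show "zs s (- t) \<in> Q d" by (auto simp: Q_def zs_conj zs_eq_iff)
    next
      assume "zs s (- t) \<in> Q d"
      then have "zsqrt2_conj (zs s (- t)) \<in> zsqrt2_conj ` Q d" by (rule imageI)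
      then show "zs s t \<in> zsqrt2_conj ` Q d" by (simp add: zs_conj)
    qed
    also have "\<dots> \<longleftrightarrow> zs s t \<in> c.Q d"
      unfolding zs_mem_Q c.zs_mem_Q
      by (subst dvd_minus_iff[symmetric]) (simp add: algebra_simps)
    finally show ?thesis .
  qed
  moreover have "zsqrt2_conj ` Q d \<subseteq> carrier zsqrt2"
    by (auto simp: Q_def zs_conj)
  ultimately show ?thesis
    using c.Q_subset[of d] by (intro equalityI subsetI) (metis carrier_zsqrt2E subsetD)+
qed

text \<open>Modulo \<open>p\<close> the form \<open>s y - t x\<close>, which cuts out \<open>Q p\<close>, is multiplicative up to the invertible
  factor \<open>y\<close>: divided by \<open>y\<close> it is the ring homomorphism to \<open>\<int>/p\<close> that sends
  \<open>\<surd>2\<close> to \<open>- x/y\<close>.\<close>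

lemma primeideal_Q:
  assumes p: "prime p" and pf: "p dvd f"
  shows "primeideal (Q p) zsqrt2"
proof (rule primeidealI)
  show "ideal (Q p) zsqrt2" by (rule ideal_Q[OF pf])
  show "cring zsqrt2" by (rule cring_zsqrt2)
  have "zs 1 0 \<notin> Q p"
  proof
    assume "zs 1 0 \<in> Q p"
    then have "p dvd y * 1" by (simp add: zs_mem_Q)
    then have "p dvd 1" by (rule dvd_cancel_y[OF pf])
    then show False using p not_prime_unit by blast
  qed
  then show "carrier zsqrt2 \<noteq> Q p" using zs_in_carrier by blast
  fix v w assume "v \<in> carrier zsqrt2" "w \<in> carrier zsqrt2" "v \<otimes>\<^bsub>zsqrt2\<^esub> w \<in> Q p"
  then obtain s t s' t' where vw: "v = zs s t" "w = zs s' t'"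
    and dvd: "p dvd (s * s' + 2 * t * t') * y - (s * t' + t * s') * x"
    by (auto simp: zs_mult zs_mem_Q elim!: carrier_zsqrt2E)
  have eq: "(s * y - t * x) * (s' * y - t' * x)
      = y * ((s * s' + 2 * t * t') * y - (s * t' + t * s') * x) + f * (t * t')"
    unfolding norm_eq[symmetric] nrm_def by Groebner_Basis.algebra
  have "p dvd (s * y - t * x) * (s' * y - t' * x)"
    unfolding eq by (rule dvd_add[OF dvd_mult[OF dvd] dvd_mult2[OF pf]])
  then show "v \<in> Q p \<or> w \<in> Q p"
    using p by (simp add: vw zs_mem_Q prime_dvd_mult_iff)
qed

text \<open>The product of \<open>(p, u)\<close> and \<open>(p, u')\<close>, with \<open>u'\<close> the conjugate of \<open>u\<close>, is generated by
  \<open>p\<^sup>2\<close>, \<open>p u\<close>, \<open>p u'\<close> and \<open>u u' = f\<close>, all of which are multiples of \<open>p\<close>.  Conversely it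
  contains \<open>p\<^sup>2\<close> and \<open>p (u + u') = 2x p\<close>, hence \<open>p\<close>.  The two prime ideals differ because
  \<open>u\<close> lies in the second one only if \<open>p\<close> divides \<open>2 x y\<close>.\<close>

lemma splits_as_Q:
  assumes p: "prime p" and pf: "p dvd f"
  shows "splits_as p (Q p)"
  unfolding splits_as_def
proof (intro conjI)
  interpret c: coprime_norm x "- y" f
    using norm_eq coprime_trace by unfold_locales (simp_all add: nrm_def)
  show "primeideal (Q p) zsqrt2" by (rule primeideal_Q[OF assms])
  show "primeideal (zsqrt2_conj ` Q p) zsqrt2"
    unfolding conj_Q by (rule c.primeideal_Q[OF assms])
  have "u \<notin> c.Q p"
  proof
    assume "u \<in> c.Q p"
    then have "p dvd y * (- (2 * x))" by (simp add: c.zs_mem_Q algebra_simps)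
    then have "p dvd - (2 * x)" by (rule dvd_cancel_y[OF pf])
    then have "p dvd 2 * x" by (simp only: dvd_minus_iff)
    then show False using coprime_trace pf p by (meson coprime_common_divisor not_prime_unit)
  qed
  then show "Q p \<noteq> zsqrt2_conj ` Q p" unfolding conj_Q using u_mem_Q by blast
  let ?P = "Q p \<cdot>\<^bsub>zsqrt2\<^esub> c.Q p"
  have P: "ideal ?P zsqrt2"
    by (rule zsqrt2.ideal_prod_is_ideal[OF ideal_Q[OF pf] c.ideal_Q[OF pf]])
  have I: "ideal (PIdl\<^bsub>zsqrt2\<^esub> (of_int p)) zsqrt2"
    by (rule zsqrt2.cgenideal_ideal) simp
  obtain g where g: "f = p * g" using pf by (auto elim: dvdE)
  have "?P \<subseteq> PIdl\<^bsub>zsqrt2\<^esub> (of_int p)"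
  proof (rule ideal_prod_subsetI[OF I])
    fix v w assume "v \<in> Q p" "w \<in> c.Q p"
    then obtain v' w' k l where c: "v' \<in> carrier zsqrt2" "w' \<in> carrier zsqrt2"
      and vw: "v = of_int p * v' + of_int k * u" "w = of_int p * w' + of_int l * c.u"
      using Q_decompose[OF pf] c.Q_decompose[OF pf] by metis
    have "v * w = of_int p * (of_int p * v' * w' + of_int l * v' * c.u + of_int k * w' * u)
        + of_int (k * l) * (u * c.u)"
      by (simp add: vw algebra_simps)
    also have "u * c.u = of_int p * of_int g" by (simp add: zs_mult_conj norm_eq g)
    finally have "v * w = (of_int p * v' * w' + of_int l * v' * c.u + of_int k * w' * u
        + of_int (k * l) * of_int g) * of_int p"
      by (simp add: algebra_simps)
    then show "v * w \<in> PIdl\<^bsub>zsqrt2\<^esub> (of_int p)"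
      unfolding PIdl_iff using c
      by (auto intro!: bexI carrier_closed of_int_in_carrier zs_in_carrier simp del: of_int_mult)
  qed
  moreover have "PIdl\<^bsub>zsqrt2\<^esub> (of_int p) \<subseteq> ?P"
  proof (rule zsqrt2.cgenideal_minimal[OF P])
    have "coprime (2 * x) p" using coprime_trace pf by (meson coprime_divisors dvd_refl)
    then obtain a b where ab: "a * (2 * x) + b * p = 1" by (rule coprime_bezout_int)
    have "of_int p = of_int (a * (2 * x) + b * p) * (of_int p :: real)"
      unfolding ab by simp
    also have "\<dots> = of_int a * (u * of_int p + of_int p * c.u) + of_int b * (of_int p * of_int p)"
      unfolding of_int_add of_int_mult[of a] u_add_conj[symmetric] by (simp add: algebra_simps)
    also have "\<dots> \<in> ?P"
      by (intro ideal_zsqrt2_addD[OF P] ideal_zsqrt2_multD[OF P] ideal_prod_memI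
          u_mem_Q c.u_mem_Q mem_Q_self c.mem_Q_self) auto
    finally show "of_int p \<in> ?P" .
  qed
  ultimately show "PIdl\<^bsub>zsqrt2\<^esub> (of_int p) = Q p \<cdot>\<^bsub>zsqrt2\<^esub> (zsqrt2_conj ` Q p)"
    unfolding conj_Q by blast
qed

lemma u_in_frakC:
  assumes f: "f > 0" shows "u \<in> frakC f"
proof -
  interpret I: comm_monoid "ideals_set zsqrt2" by (rule zsqrt2.ideals_set_is_comm_monoid)
  have prod: "(\<Prod>p\<in>prime_factors f. p ^ multiplicity p f) = f"
    using f prod_prime_factors[of f] by simp
  have ideal: "ideal (Q (p ^ multiplicity p f)) zsqrt2" for p
    by (rule ideal_Q) (rule multiplicity_dvd)
  have "PIdl\<^bsub>zsqrt2\<^esub> u = (\<Otimes>\<^bsub>ideals_set zsqrt2\<^esub> p\<in>prime_factors f. Q (p ^ multiplicity p f))"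
    using Q_finprod[of "prime_factors f" "\<lambda>p. p ^ multiplicity p f"] by (simp add: prod Q_norm)
  also have "\<dots> = (\<Otimes>\<^bsub>ideals_set zsqrt2\<^esub> p\<in>prime_factors f.
      Q p [^]\<^bsub>ideals_set zsqrt2\<^esub> multiplicity p f)"
  proof (rule I.finprod_cong'[OF refl])
    show "(\<lambda>p. Q p [^]\<^bsub>ideals_set zsqrt2\<^esub> multiplicity p f) \<in> prime_factors f \<rightarrow> carrier (ideals_set zsqrt2)"
    proof (rule Pi_I)
      fix p
      show "Q p [^]\<^bsub>ideals_set zsqrt2\<^esub> multiplicity p f \<in> carrier (ideals_set zsqrt2)"
        unfolding Q_power[OF multiplicity_dvd] using ideal by (simp add: ideals_set_def)
    qed
  qed (simp add: Q_power multiplicity_dvd)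
  finally have "PIdl\<^bsub>zsqrt2\<^esub> u = \<dots>" .
  moreover have "splits_as p (Q p)" if "p \<in> prime_factors f" for p
    using that by (intro splits_as_Q) auto
  ultimately show ?thesis
    unfolding frakC_def by (auto simp: zs_conj zs_mult_conj norm_eq intro!: exI[of _ Q])
qed

end

section \<open>Units of norm \<open>-1\<close>\<close>

lemma zsqrt2_gamma_eq: "zsqrt2_gamma = zs 1 1"
  by (simp add: zsqrt2_gamma_def zs_def)

lemma zsqrt2_delta_eq: "zsqrt2_delta = zs 3 2"
  by (simp add: zsqrt2_delta_def zsqrt2_gamma_eq power2_eq_square zs_mult zs_eq_iff)

lemma delta_gt_1: "zsqrt2_delta > 1"
proof -
  have "0 < sqrt 2" by simp
  then show ?thesis unfolding zsqrt2_delta_eq zs_def by linarith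
qed

lemma delta_powi:
  "\<exists>x y. zsqrt2_delta powi m = zs x y \<and> nrm x y = 1"
proof -
  have pow: "\<exists>x y. zsqrt2_delta ^ n = zs x y \<and> nrm x y = 1" for n
  proof (induction n)
    case 0
    show ?case by (intro exI[of _ 1] exI[of _ 0]) (simp add: zs_def nrm_def)
  next
    case (Suc n)
    then obtain x y where xy: "zsqrt2_delta ^ n = zs x y" "nrm x y = 1" by blast
    have "zsqrt2_delta ^ Suc n = zs (3 * x + 2 * 2 * y) (3 * y + 2 * x)"
      by (simp only: power_Suc xy) (simp add: zsqrt2_delta_eq zs_mult)
    moreover have "nrm (3 * x + 2 * 2 * y) (3 * y + 2 * x) = 1"
      unfolding nrm_mult by (simp add: xy) (simp add: nrm_def)
    ultimately show ?case by blast
  qed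
  show ?thesis
  proof (cases "m \<ge> 0")
    case True
    then show ?thesis using pow[of "nat m"] by (simp add: power_int_def)
  next
    case False
    obtain x y where xy: "zsqrt2_delta ^ nat (- m) = zs x y" "nrm x y = 1" using pow by blast
    have "zs x y * zs x (- y) = 1" by (simp add: zs_mult_conj xy)
    then have "inverse (zs x y) = zs x (- y)" by (rule inverse_unique)
    then have "zsqrt2_delta powi m = zs x (- y)"
      using False xy by (simp add: power_int_def power_inverse)
    moreover have "nrm x (- y) = 1" using xy by (simp add: nrm_def)
    ultimately show ?thesis by blast
  qed
qed

text \<open>The conjugate of such a unit \<open>w\<close> is \<open>1/w\<close>, so \<open>2x = w + 1/w\<close> is positive and less than
  \<open>\<delta> + 1 < 7\<close>; this leaves \<open>x \<in> {1, 2, 3}\<close>.  Here \<open>x = 2\<close> is excluded by parity, and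
  \<open>x = 3\<close> by the interval, since \<open>3 \<plusminus> 2\<surd>2\<close> are \<open>\<delta>\<close> and \<open>1/\<delta>\<close>.\<close>

lemma unit_in_fundamental_domain:
  assumes n: "nrm x y = 1" and ge: "1 \<le> zs x y" and less: "zs x y < zsqrt2_delta"
  shows "zs x y = 1"
proof -
  have inv: "zs x y * zs x (- y) = 1" by (simp add: zs_mult_conj n)
  have pos: "zs x (- y) > 0"
    using inv ge by (smt (verit) mult_nonneg_nonpos)
  have le: "zs x (- y) \<le> 1"
    using mult_right_mono[OF ge, of "zs x (- y)"] inv pos by simp
  have sum: "zs x y + zs x (- y) = 2 * of_int x" by (simp add: zs_def)
  have s2: "sqrt 2 < 3 / 2"
    by (rule real_less_lsqrt) (simp_all add: power2_eq_square)
  have "zsqrt2_delta < 6"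
    using s2 by (simp add: zsqrt2_delta_eq zs_def)
  then have "0 < x" "x < 4" using sum pos le ge less by linarith+
  then have "x = 1 \<or> x = 2 \<or> x = 3" by linarith
  moreover have "x \<noteq> 2"
  proof
    assume "x = 2"
    then have "3 = 2 * y\<^sup>2" using n by (simp add: nrm_def)
    then show False by presburger
  qed
  moreover have "x \<noteq> 3"
  proof
    assume x: "x = 3"
    then have "y\<^sup>2 = 2\<^sup>2" using n by (simp add: nrm_def)
    then have "y = 2 \<or> y = - 2" by (simp only: power2_eq_iff)
    then show False
    proof
      assume "y = 2"
      then show False using less x by (simp add: zsqrt2_delta_eq)
    next
      assume "y = - 2"
      then have "zs x (- y) = 3 + 2 * sqrt 2" using x by (simp add: zs_def)
      moreover have "0 < sqrt 2" by simp
      ultimately have "zs x (- y) > 1" by linarith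
      then show False using le by simp
    qed
  qed
  ultimately have x: "x = 1" by blast
  then have "y = 0" using n by (simp add: nrm_def)
  with x show ?thesis by (simp add: zs_def)
qed

text \<open>A suitable power of \<open>\<delta>\<close> moves the unit into \<open>[1, \<delta>)\<close>.\<close>

lemma pos_unit_norm_1:
  assumes n: "nrm x y = 1" and pos: "zs x y > 0"
  shows "\<exists>m. zs x y = zsqrt2_delta powi m"
proof -
  define k where "k = \<lfloor>log zsqrt2_delta (zs x y)\<rfloor>"
  note d = delta_gt_1
  have powr: "zsqrt2_delta powr of_int j = zsqrt2_delta powi j" for j
    using d by (simp add: powr_real_of_int')
  have "zsqrt2_delta powi k \<le> zs x y"
    using d pos by (simp add: powr[symmetric] k_def le_log_iff[symmetric])
  moreover have "zs x y < zsqrt2_delta powi (k + 1)"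
    unfolding powr[symmetric] using d pos
    by (subst log_less_iff[symmetric]) (auto simp: k_def)
  moreover obtain a b where ab: "zsqrt2_delta powi (- k) = zs a b" "nrm a b = 1"
    using delta_powi by blast
  define x' y' where "x' = x * a + 2 * y * b" and "y' = x * b + y * a"
  have zs': "zs x' y' = zs x y * zsqrt2_delta powi (- k)"
    by (simp add: ab x'_def y'_def zs_mult)
  have p: "zsqrt2_delta powi k > 0" using d by simp
  ultimately have "1 \<le> zs x' y'" "zs x' y' < zsqrt2_delta"
    using d by (simp_all add: zs' power_int_minus power_int_add field_simps)
  moreover have "nrm x' y' = 1"
    by (simp add: x'_def y'_def nrm_mult n ab)
  ultimately have "zs x' y' = 1" by (rule unit_in_fundamental_domain[rotated])
  then have "zs x y = zsqrt2_delta powi k"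
    using p by (simp add: zs' power_int_minus field_simps)
  then show ?thesis by blast
qed

lemma unit_norm_minus_1:
  assumes n: "nrm x y = - 1"
  shows "\<exists>m. \<exists>s\<in>{1, -1}. zs x y = s * zsqrt2_gamma * zsqrt2_delta powi m"
proof -
  \<comment> \<open>These are the coordinates of the quotient by \<open>\<gamma>\<close>, whose inverse is \<open>- 1 + \<surd>2\<close>.\<close>
  define x' y' where "x' = 2 * y - x" and "y' = x - y"
  have g: "zs x y = zsqrt2_gamma * zs x' y'"
    by (simp add: zsqrt2_gamma_eq zs_mult zs_eq_iff x'_def y'_def)
  have n': "nrm x' y' = 1"
    using n unfolding nrm_def x'_def y'_def by Groebner_Basis.algebra
  then have "zs x' y' \<noteq> 0" using zs_mult_conj[of x' y'] by auto
  then consider "zs x' y' > 0" | "zs (- x') (- y') > 0"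
    by (force simp: zs_def)
  then show ?thesis
  proof cases
    case 1
    then show ?thesis using pos_unit_norm_1[OF n'] by (auto simp: g)
  next
    case 2
    have "nrm (- x') (- y') = 1" using n' by (simp add: nrm_def)
    then obtain m where "zs (- x') (- y') = zsqrt2_delta powi m"
      using pos_unit_norm_1 2 by blast
    then have "zs x' y' = - (zsqrt2_delta powi m)" by (simp add: zs_def)
    then show ?thesis by (auto simp: g)
  qed
qed

lemma nrm_of_mult:
  assumes "zs a b = zs c d * zs e g" shows "nrm a b = nrm c d * nrm e g"
  using assms nrm_mult[of c e d g] by (simp add: zs_mult zs_eq_iff)

section \<open>Elements of norm \<open>-f\<^sup>2\<close>\<close>

text \<open>Write \<open>z\<close> for the given element, \<open>z'\<close> for its conjugate, and let \<open>u = \<alpha> z + \<beta> f\<close> generate the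
  ideal \<open>(z, f)\<close>.  The equality \<open>(u)\<^sup>2 = (z)\<close> becomes explicit through mutually inverse units
  \<open>v\<close> and \<open>w\<close> with \<open>z = u\<^sup>2 v\<close> and \<open>u\<^sup>2 = z w\<close>: the second comes from
  expanding \<open>u\<^sup>2\<close> with \<open>f\<^sup>2 = - z z'\<close>, the first from writing \<open>z\<close> as a combination of
  \<open>z\<^sup>2 - f\<^sup>2 = 2X z\<close> and \<open>f z\<close>, both divisible by \<open>u\<^sup>2\<close>.\<close>

lemma norm_minus_square_decompose:
  assumes n: "nrm X Y = - f\<^sup>2" and f: "f > 0" and cop: "coprime (2 * X) f"
  obtains x y v w where "nrm x y = f" "nrm v w = - 1" "zs X Y = (zs x y)\<^sup>2 * zs v w"
proof -
  define z where "z = zs X Y"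
  define I where "I = {\<alpha> * z + \<beta> * of_int f | \<alpha> \<beta>. \<alpha> \<in> carrier zsqrt2 \<and> \<beta> \<in> carrier zsqrt2}"
  have z_carr: "z \<in> carrier zsqrt2" by (simp add: z_def)
  have I_memI: "\<alpha> * z + \<beta> * of_int f \<in> I"
    if "\<alpha> \<in> carrier zsqrt2" "\<beta> \<in> carrier zsqrt2" for \<alpha> \<beta>
    using that by (auto simp: I_def)
  have 01: "0 \<in> carrier zsqrt2" "1 \<in> carrier zsqrt2"
    using of_int_in_carrier[of 0] of_int_in_carrier[of 1] by simp_all
  have "ideal I zsqrt2"
  proof (rule ideal_zsqrt2I)
    show "I \<subseteq> carrier zsqrt2"
      unfolding I_def using z_carr by (auto intro!: carrier_closed)
    show "0 \<in> I" using I_memI[OF 01(1) 01(1)] by simp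
  next
    fix u v assume "u \<in> I" "v \<in> I"
    then obtain \<alpha> \<beta> \<alpha>' \<beta>' where c: "\<alpha> \<in> carrier zsqrt2" "\<beta> \<in> carrier zsqrt2"
      "\<alpha>' \<in> carrier zsqrt2" "\<beta>' \<in> carrier zsqrt2"
      and uv: "u = \<alpha> * z + \<beta> * of_int f" "v = \<alpha>' * z + \<beta>' * of_int f"
      by (auto simp: I_def)
    have "u + v = (\<alpha> + \<alpha>') * z + (\<beta> + \<beta>') * of_int f" by (simp add: uv algebra_simps)
    then show "u + v \<in> I" using c by (auto intro!: I_memI carrier_closed)
  next
    fix r u assume "r \<in> carrier zsqrt2" "u \<in> I"
    then obtain \<alpha> \<beta> where c: "\<alpha> \<in> carrier zsqrt2" "\<beta> \<in> carrier zsqrt2" "r \<in> carrier zsqrt2"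
      and u: "u = \<alpha> * z + \<beta> * of_int f"
      by (auto simp: I_def)
    have "r * u = (r * \<alpha>) * z + (r * \<beta>) * of_int f" by (simp add: u algebra_simps)
    then show "r * u \<in> I" using c by (auto intro!: I_memI carrier_closed)
  qed
  then obtain u where "u \<in> I" and I: "I = PIdl\<^bsub>zsqrt2\<^esub> u"
    using ideal_zsqrt2_principal by blast
  then obtain \<alpha> \<beta> where \<alpha>\<beta>: "\<alpha> \<in> carrier zsqrt2" "\<beta> \<in> carrier zsqrt2"
    and u: "u = \<alpha> * z + \<beta> * of_int f"
    by (auto simp: I_def)
  have "z \<in> I" "of_int f \<in> I" using I_memI[OF 01(2,1)] I_memI[OF 01] by simp_all
  then obtain \<kappa> \<mu> where mult: "\<kappa> \<in> carrier zsqrt2" "\<mu> \<in> carrier zsqrt2"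
    and zf: "z = \<kappa> * u" "of_int f = \<mu> * u"
    unfolding I PIdl_iff by auto
  define z' where "z' = zs X (- Y)"
  have zz': "(of_int f)\<^sup>2 = - (z * z')" "z + z' = of_int (2 * X)"
    using n by (simp_all add: z_def z'_def zs_mult_conj) (simp add: zs_def)
  obtain a b where ab: "a * (2 * X) + b * f = 1" using cop by (rule coprime_bezout_int)
  define v where "v = of_int a * (\<kappa>\<^sup>2 - \<mu>\<^sup>2) + of_int b * (\<kappa> * \<mu>)"
  define w where "w = \<alpha>\<^sup>2 * z + 2 * \<alpha> * \<beta> * of_int f - \<beta>\<^sup>2 * z'"
  have 2: "(2::real) \<in> carrier zsqrt2" using of_int_in_carrier[of 2] by simp
  have z'_carr: "z' \<in> carrier zsqrt2" by (simp add: z'_def)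
  have carr: "u \<in> carrier zsqrt2" "v \<in> carrier zsqrt2" "w \<in> carrier zsqrt2"
    unfolding u v_def w_def power2_eq_square using \<alpha>\<beta> mult z_carr z'_carr 2
    by (auto intro!: carrier_closed)
  have "u\<^sup>2 = \<alpha>\<^sup>2 * z\<^sup>2 + 2 * \<alpha> * \<beta> * of_int f * z + \<beta>\<^sup>2 * (of_int f)\<^sup>2"
    unfolding u by (simp add: power2_eq_square algebra_simps)
  then have uw: "u\<^sup>2 = z * w"
    unfolding zz' w_def by (simp add: power2_eq_square algebra_simps)
  have "z = of_int (a * (2 * X) + b * f) * z" by (simp add: ab)
  also have "\<dots> = of_int a * ((z + z') * z) + of_int b * (z * of_int f)"
    unfolding zz' by (simp add: algebra_simps)
  also have "(z + z') * z = z\<^sup>2 - (of_int f)\<^sup>2"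
    unfolding zz'(1) by (simp add: power2_eq_square algebra_simps)
  also have "of_int a * (z\<^sup>2 - (of_int f)\<^sup>2) + of_int b * (z * of_int f) = u\<^sup>2 * v"
    unfolding v_def zf by (simp add: power2_eq_square algebra_simps)
  finally have zuv: "z = u\<^sup>2 * v" .
  have "z \<noteq> 0" using zz'(1) f by auto
  moreover have "z * (w * v) = z" using zuv uw by simp
  ultimately have wv: "w * v = 1" by simp
  obtain x y v1 v2 w1 w2 where c: "u = zs x y" "v = zs v1 v2" "w = zs w1 w2"
    using carr by (metis carrier_zsqrt2E)
  have "zs 1 0 = zs w1 w2 * zs v1 v2" using wv by (simp add: c zs_def)
  then have "nrm 1 0 = nrm w1 w2 * nrm v1 v2" by (rule nrm_of_mult)
  then have "nrm w1 w2 * nrm v1 v2 = 1" by (simp add: nrm_def)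
  then have v_unit: "nrm v1 v2 = 1 \<or> nrm v1 v2 = - 1"
    by (metis mult.commute zmult_eq_1_iff)
  obtain s t where st: "u\<^sup>2 = zs s t" "nrm s t = (nrm x y)\<^sup>2"
    using nrm_of_mult[of _ _ x y x y] by (simp add: c power2_eq_square zs_mult)
  have "nrm X Y = nrm s t * nrm v1 v2"
    using zuv by (intro nrm_of_mult) (simp only: st(1) c(2) z_def)
  then have N: "- f\<^sup>2 = (nrm x y)\<^sup>2 * nrm v1 v2" using st n by simp
  have v_norm: "nrm v1 v2 = - 1"
  proof (rule ccontr)
    assume "nrm v1 v2 \<noteq> - 1"
    then have "- f\<^sup>2 = (nrm x y)\<^sup>2" using v_unit N by simp
    moreover have "0 < f\<^sup>2" using f by simp
    ultimately show False using zero_le_power2[of "nrm x y"] by linarith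
  qed
  then have "nrm x y = f \<or> nrm x y = - f" using N by (auto simp: power2_eq_iff)
  then show thesis
  proof
    assume "nrm x y = f"
    then show thesis using that v_norm zuv by (simp add: c z_def)
  next
    assume neg: "nrm x y = - f"
    \<comment> \<open>Multiplying \<open>u\<close> by \<open>\<gamma>\<close>, which has norm \<open>-1\<close>, is compensated in the unit by
      \<open>1/\<gamma>\<^sup>2 = 3 - 2\<surd>2\<close>.\<close>
    obtain x' y' where u': "zs x' y' = zs x y * zs 1 1" by (simp add: zs_mult)
    obtain v1' v2' where v': "zs v1' v2' = zs v1 v2 * zs 3 (- 2)" by (simp add: zs_mult)
    have "zs 1 1 * zs 1 1 * zs 3 (- 2) = 1"
      by (simp add: zs_mult) (simp add: zs_def)
    moreover have "(zs x' y')\<^sup>2 * zs v1' v2' = (zs x y)\<^sup>2 * zs v1 v2 * (zs 1 1 * zs 1 1 * zs 3 (- 2))"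
      unfolding u' v' by (simp only: power2_eq_square ac_simps)
    ultimately have "zs X Y = (zs x' y')\<^sup>2 * zs v1' v2'" using zuv by (simp add: c z_def)
    moreover have "nrm x' y' = f" "nrm v1' v2' = - 1"
      using nrm_of_mult[OF u'] nrm_of_mult[OF v'] neg v_norm by (simp_all add: nrm_def)
    ultimately show thesis using that by blast
  qed
qed

lemma coprime_if_no_common_prime:
  fixes m n :: int
  assumes "n \<noteq> 0" "\<And>p. prime p \<Longrightarrow> p dvd m \<Longrightarrow> p dvd n \<Longrightarrow> False"
  shows "coprime m n"
proof (rule ccontr)
  assume "\<not> coprime m n"
  then have "\<not> is_unit (gcd m n)" by (simp only: is_unit_gcd not_False_eq_True)
  then obtain p where "prime p" "p dvd gcd m n"
    using prime_divisor_exists[of "gcd m n"] assms(1) by auto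
  then show False using assms(2)[of p] by simp
qed

text \<open>A prime dividing both numbers and different from 2 divides \<open>a + b\<close> and \<open>b - a\<close>, hence \<open>a\<close>, \<open>b\<close> and
  \<open>c\<close>.  The prime 2 is no exception: \<open>a\<close> and \<open>b\<close> of equal parity are not both odd, because then
  \<open>c\<^sup>2\<close> would be 2 modulo 4.\<close>

lemma primitive_triple_coprime_trace:
  fixes a b c :: int
  assumes neq: "a \<noteq> b" and pyth: "pythagorean_triple a b c" and prim: "primitive_triple a b c"
  shows "coprime (2 * (a + b)) (b - a)"
proof (rule coprime_if_no_common_prime)
  show "b - a \<noteq> 0" using neq by simp
  fix p :: int assume p: "prime p" and dvd: "p dvd 2 * (a + b)" "p dvd b - a"
  have eq: "a\<^sup>2 + b\<^sup>2 = c\<^sup>2" using pyth by (simp add: pythagorean_triple_def)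
  have "p dvd a"
  proof (cases "p = 2")
    case True
    show ?thesis
    proof (rule ccontr)
      assume "\<not> p dvd a"
      then have "odd a" "odd b" using True dvd by auto
      then obtain k l where "a = 2 * k + 1" "b = 2 * l + 1" by (auto elim!: oddE)
      then have c: "c\<^sup>2 = 4 * (k\<^sup>2 + k + l\<^sup>2 + l) + 2"
        using eq by (simp add: power2_eq_square algebra_simps)
      then have "even (c\<^sup>2)" by simp
      then obtain m where "c = 2 * m" by auto
      then have "4 * m\<^sup>2 = 4 * (k\<^sup>2 + k + l\<^sup>2 + l) + 2" using c by (simp add: power_mult_distrib)
      then show False by presburger
    qed
  next
    case False
    then have "\<not> p dvd 2" using p using primes_dvd_imp_eq[of p 2] by auto
    moreover have "p dvd 2 * (2 * a)"
      using dvd_diff[OF dvd(1) dvd_mult[OF dvd(2), of 2]] by (simp add: algebra_simps)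
    ultimately show ?thesis using p by (metis prime_dvd_mult_iff)
  qed
  then have "p dvd b" using dvd_add[OF dvd(2), of a] by simp
  then have "p dvd a\<^sup>2 + b\<^sup>2"
    unfolding power2_eq_square using \<open>p dvd a\<close> by (intro dvd_add dvd_mult)
  then have "p dvd c\<^sup>2" unfolding eq .
  then have "p dvd c" using p by (simp add: prime_dvd_power_iff)
  then show False
    using prim \<open>p dvd a\<close> \<open>p dvd b\<close> prime_gt_1_int[OF p]
    unfolding primitive_triple_def by (metis less_numeral_extra(4) order.strict_trans zero_less_one)
qed

theorem theorem3p7:
  fixes a b c f :: int
  assumes "f > 0"
    and "b = a + f"
    and "pythagorean_triple a b c"
    and "primitive_triple a b c"
  shows "\<exists>(m::int) (s::real) (u::real) (X::int) (Y::int).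
           s \<in> {1, -1} \<and> u \<in> frakC f \<and>
           real_of_int X + real_of_int Y * sqrt 2 = s * zsqrt2_gamma * zsqrt2_delta powi m * u\<^sup>2 \<and>
           real_of_int a = (real_of_int X - real_of_int f) / 2 \<and>
           real_of_int b = (real_of_int X + real_of_int f) / 2 \<and>
           c = Y"
proof -
  define X where "X = a + b"
  have f: "f = b - a" using assms(2) by simp
  have cop: "coprime (2 * X) f"
    unfolding X_def f using assms by (intro primitive_triple_coprime_trace) auto
  have "a\<^sup>2 + b\<^sup>2 = c\<^sup>2" using assms(3) by (simp add: pythagorean_triple_def)
  then have "nrm X c = - f\<^sup>2"
    unfolding nrm_def X_def f by Groebner_Basis.algebra
  then obtain x y v w where xy: "nrm x y = f" and vw: "nrm v w = - 1"
    and z: "zs X c = (zs x y)\<^sup>2 * zs v w"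
    using norm_minus_square_decompose assms(1) cop by metis
  \<comment> \<open>A common prime divisor would divide \<open>x\<close> and \<open>y\<close>, hence \<open>z\<close> and in particular \<open>X\<close>.\<close>
  have "coprime (2 * x) f"
  proof (rule coprime_if_no_common_prime)
    show "f \<noteq> 0" using assms(1) by simp
    fix p :: int assume p: "prime p" and dvd: "p dvd 2 * x" "p dvd f"
    have "\<not> p dvd 2"
    proof
      assume "p dvd 2"
      then have "p dvd 2 * X" by simp
      then show False using cop dvd(2) p by (meson coprime_common_divisor not_prime_unit)
    qed
    then have px: "p dvd x" using dvd(1) p by (simp add: prime_dvd_mult_iff)
    have "2 * y\<^sup>2 = x * x - f" using xy by (simp add: nrm_def power2_eq_square)
    then have "p dvd 2 * y\<^sup>2" using px dvd(2) by (simp only: dvd_diff dvd_mult)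
    then have "p dvd y" using p \<open>\<not> p dvd 2\<close> by (simp add: prime_dvd_mult_iff prime_dvd_power_iff)
    have "X = (x * x + 2 * y * y) * v + 2 * (x * y + y * x) * w"
      using z by (simp add: power2_eq_square zs_mult zs_eq_iff)
    then have "p dvd X" using px \<open>p dvd y\<close> by simp
    then show False using cop dvd(2) p by (meson coprime_common_divisor dvd_mult not_prime_unit)
  qed
  then interpret coprime_norm x y f
    using xy by unfold_locales
  obtain m s where s: "s \<in> {1, -1}" and ms: "zs v w = s * zsqrt2_gamma * zsqrt2_delta powi m"
    using unit_norm_minus_1[OF vw] by blast
  show ?thesis
  proof (intro exI conjI)
    show "s \<in> {1, -1}" by (rule s)
    show "zs x y \<in> frakC f" using assms(1) by (rule u_in_frakC)
    show "real_of_int X + real_of_int c * sqrt 2 = s * zsqrt2_gamma * zsqrt2_delta powi m * (zs x y)\<^sup>2"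
      using z ms by (simp add: zs_def[of X c] mult.commute)
    show "real_of_int a = (real_of_int X - real_of_int f) / 2"
      "real_of_int b = (real_of_int X + real_of_int f) / 2"
      by (simp_all add: X_def f)
  qed simp
qed

end
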